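(* Let $F$ be a non-abelian free group and let integers $h,k,c,v$ satisfy $2\le h\le k$, $2\le v\le h+k$, $0\le c\le (h-1)(k-1)+1$. Define a finite sequence $a_0,\dots,a_{h+k-2}$ by \[ a_0=0;\qquad a_i=\Big\lfloor \frac{i^2}{4}\Big\rfloor+1 \ \text{ for } i=1,\dots,2(h-1);\qquad a_i=(h-1)(i-h+1)+1 \ \text{ for } i=2(h-1),\dots,h+k-2. \] Put $i=h+k-v$. If $c\le a_i$, then there exist subgroups $H,K\le F$ such that $\operatorname{rk}(H)=h$, $\operatorname{rk}(K)=k$, $\operatorname{rk}(H\cap K)=c$ and $\operatorname{rk}(H\vee K)=v$.
   Context: $H\vee K$ denotes the subgroup of $F$ generated by $H$ and $K$; $\operatorname{rk}$ denotes the rank of a free group. *)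

theory Defs
  imports "HOL-Algebra.Algebra"
begin

definition letter_val :: "('a, 'b) monoid_scheme \<Rightarrow> 'a \<times> bool \<Rightarrow> 'a" where
  "letter_val G w = (if snd w then fst w else inv\<^bsub>G\<^esub> (fst w))"

definition word_val :: "('a, 'b) monoid_scheme \<Rightarrow> ('a \<times> bool) list \<Rightarrow> 'a" where
  "word_val G ws = foldr (\<lambda>w acc. letter_val G w \<otimes>\<^bsub>G\<^esub> acc) ws \<one>\<^bsub>G\<^esub>"

definition reduced_word :: "('a \<times> bool) list \<Rightarrow> bool" where
  "reduced_word ws = (\<forall>i. Suc i < length ws \<longrightarrow>
      \<not> (fst (ws ! i) = fst (ws ! Suc i) \<and> snd (ws ! i) \<noteq> snd (ws ! Suc i)))"

definition free_basis :: "('a, 'b) monoid_scheme \<Rightarrow> 'a set \<Rightarrow> 'a set \<Rightarrow> bool" where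
  "free_basis G S H = (S \<subseteq> carrier G \<and> generate G S = H \<and>
     (\<forall>ws. ws \<noteq> [] \<and> set (map fst ws) \<subseteq> S \<and> reduced_word ws \<longrightarrow> word_val G ws \<noteq> \<one>\<^bsub>G\<^esub>))"

definition has_rank :: "('a, 'b) monoid_scheme \<Rightarrow> 'a set \<Rightarrow> nat \<Rightarrow> bool" where
  "has_rank G H n = (\<exists>S. free_basis G S H \<and> finite S \<and> card S = n)"

(* the sequence a_0, ..., a_{h+k-2} (depends only on h for the given range) *)
definition seq_a :: "nat \<Rightarrow> nat \<Rightarrow> nat" where
  "seq_a h i = (if i = 0 then 0
                else if i \<le> 2 * (h - 1) then i\<^sup>2 div 4 + 1
                else (h - 1) * (i - h + 1) + 1)"

end

theory Submission
  imports Defs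
begin

text \<open>
  Write \<open>h + k - v = p + q\<close> with \<open>p < h\<close>, \<open>q < k\<close> and \<open>c \<le> p q + 1\<close> (and \<open>c = 0\<close> if \<open>p = q = 0\<close>). In a free group of rank \<open>v\<close> on
  \<open>x, y\<close> and further letters, distributed over two sets \<open>E\<close> and \<open>E'\<close>, let \<open>H\<close> be generated by \<open>E\<close> and
  \<open>x\<^sup>i y x\<^sup>-\<^sup>i\<close> for \<open>0 \<le> i \<le> p\<close>, and \<open>K\<close> by \<open>E'\<close>, \<open>z\<^sub>0 = x\<close> and \<open>z\<^sub>j = y\<^sup>j x\<^sup>n y\<^sup>-\<^sup>j\<close> for \<open>1 \<le> j \<le> q\<close>, with
  exponents \<open>n = n\<^sub>j\<close> in \<open>{1..p + 1}\<close>. Together they generate the whole group. Give \<open>x\<close> weight 1, the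
  letters of \<open>E'\<close> weight \<open>p + 1\<close> and the others weight 0. The prefixes of reduced words in \<open>H\<close> have
  weights in \<open>{0..p}\<close>, while the reduced form of a word in the generators of \<open>K\<close> attains the weights
  of all its prefixes. So \<open>H \<inter> K\<close> consists of the words in the \<open>z\<^sub>j\<close> whose prefix weights stay in
  \<open>{0..p}\<close> and which end at weight 0: closed paths in the graph on \<open>{0..p}\<close> with a \<open>j\<close>-edge from
  \<open>i\<close> to \<open>i + n\<^sub>j\<close>. The 0-edges form a spanning tree, so \<open>H \<inter> K\<close> is free of rank
  \<open>\<Sum>j = 1..q. p + 1 - n\<^sub>j\<close>, which takes all values up to \<open>p q\<close>. For \<open>p q + 1\<close> replace \<open>z\<^sub>q\<close> by a power of
  \<open>y\<close> (the case \<open>n\<^sub>q = 0\<close>) and take all other \<open>n\<^sub>j = 1\<close>.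
\<close>

section \<open>Reduced words, inverse words and powers of a letter\<close>

definition cancels :: "'i \<times> bool \<Rightarrow> 'i \<times> bool \<Rightarrow> bool" where
  "cancels l l' \<longleftrightarrow> fst l = fst l' \<and> snd l \<noteq> snd l'"

lemma reduced_word_iff: "reduced_word ws \<longleftrightarrow> successively (\<lambda>l l'. \<not> cancels l l') ws"
  unfolding reduced_word_def cancels_def successively_conv_nth by (auto simp: less_diff_conv)

definition inv_word :: "('i \<times> bool) list \<Rightarrow> ('i \<times> bool) list" where
  "inv_word ws = rev (map (map_prod id Not) ws)"

lemma reduced_word_inv_word: "reduced_word ws \<Longrightarrow> reduced_word (inv_word ws)"
  by (simp add: reduced_word_iff inv_word_def successively_rev successively_map cancels_def)
     (erule successively_mono, auto)

lemma fst_set_inv_word: "fst ` set (inv_word ws) = fst ` set ws"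
  by (force simp: inv_word_def)

definition pow_word :: "'i \<Rightarrow> int \<Rightarrow> ('i \<times> bool) list" where
  "pow_word t n = replicate (nat \<bar>n\<bar>) (t, 0 \<le> n)"

lemma fst_set_pow_word: "fst ` set (pow_word t n) \<subseteq> {t}"
  by (auto simp: pow_word_def)

lemma successively_replicate: "P a a \<Longrightarrow> successively P (replicate n a)"
  by (simp add: successively_conv_nth)

lemma reduced_word_replicate_append:
  "reduced_word (replicate n l @ ws) \<longleftrightarrow>
     reduced_word ws \<and> (n = 0 \<or> ws = [] \<or> \<not> cancels l (hd ws))"
  by (auto simp: reduced_word_iff successively_append_iff successively_replicate cancels_def)

lemma reduced_word_pow_word_append:
  "reduced_word (pow_word t n @ ws) \<longleftrightarrow>
     reduced_word ws \<and> (n = 0 \<or> ws = [] \<or> \<not> cancels (t, 0 \<le> n) (hd ws))"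
  by (simp add: pow_word_def reduced_word_replicate_append)

lemma reduced_word_Cons:
  "reduced_word (l # ws) \<longleftrightarrow> reduced_word ws \<and> (ws = [] \<or> \<not> cancels l (hd ws))"
  by (auto simp: reduced_word_iff successively_Cons)

section \<open>Weights of words and the paths they trace on the integers\<close>

definition letter_weight :: "('i \<Rightarrow> int) \<Rightarrow> 'i \<times> bool \<Rightarrow> int" where
  "letter_weight wt l = (if snd l then wt (fst l) else - wt (fst l))"

definition word_weight :: "('i \<Rightarrow> int) \<Rightarrow> ('i \<times> bool) list \<Rightarrow> int" where
  "word_weight wt ws = (\<Sum>l\<leftarrow>ws. letter_weight wt l)"

text \<open>A word is read as a path on the integers starting at \<open>c\<close>; both endpoints
  count as visited.\<close>

fun heights :: "('i \<Rightarrow> int) \<Rightarrow> int \<Rightarrow> ('i \<times> bool) list \<Rightarrow> int set" where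
  "heights wt c [] = {c}"
| "heights wt c (l # ws) = insert c (heights wt (c + letter_weight wt l) ws)"

lemma word_weight_simps [simp]:
  "word_weight wt [] = 0"
  "word_weight wt (l # ws) = letter_weight wt l + word_weight wt ws"
  "word_weight wt (us @ ws) = word_weight wt us + word_weight wt ws"
  "word_weight wt (replicate n l) = int n * letter_weight wt l"
  by (auto simp: word_weight_def sum_list_replicate)

lemma word_weight_pow_word [simp]: "word_weight wt (pow_word t n) = n * wt t"
  by (auto simp: pow_word_def letter_weight_def)

lemma start_in_heights: "c \<in> heights wt c ws"
  by (cases ws) auto

lemma heights_append:
  "heights wt c (us @ ws) = heights wt c us \<union> heights wt (c + word_weight wt us) ws"
  by (induction us arbitrary: c) (auto simp: start_in_heights add.assoc)

lemma heights_replicate: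
  "heights wt c (replicate n l) = (\<lambda>m. c + int m * letter_weight wt l) ` {..n}"
proof (induction n arbitrary: c)
  case (Suc n)
  show ?case
    by (auto simp: Suc atMost_Suc_eq_insert_0 image_image algebra_simps)
qed simp

section \<open>Free families and reduced forms\<close>

context group
begin

text \<open>Letters are indices rather than group elements, so generators given by formulas can be
  handled directly, and injectivity of a free family becomes a consequence instead of an
  assumption.\<close>

definition fam_val :: "('i \<Rightarrow> 'a) \<Rightarrow> ('i \<times> bool) list \<Rightarrow> 'a" where
  "fam_val g ws = word_val G (map (map_prod g id) ws)"

definition free_family :: "('i \<Rightarrow> 'a) \<Rightarrow> 'i set \<Rightarrow> bool" where
  "free_family g I \<longleftrightarrow> g ` I \<subseteq> carrier G \<and>
     (\<forall>ws. ws \<noteq> [] \<and> fst ` set ws \<subseteq> I \<and> reduced_word ws \<longrightarrow> fam_val g ws \<noteq> \<one>)"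

lemma fam_val_Nil [simp]: "fam_val g [] = \<one>"
  by (simp add: fam_val_def word_val_def)

lemma fam_val_Cons:
  "fam_val g (l # ws) = (if snd l then g (fst l) else inv (g (fst l))) \<otimes> fam_val g ws"
  by (simp add: fam_val_def word_val_def letter_val_def)

lemma fam_val_closed:
  assumes "g ` I \<subseteq> carrier G" "fst ` set ws \<subseteq> I"
  shows "fam_val g ws \<in> carrier G"
  using assms(2) by (induction ws) (use assms(1) in \<open>auto simp: fam_val_Cons\<close>)

lemma fam_val_append:
  assumes "g ` I \<subseteq> carrier G" "fst ` set us \<subseteq> I" "fst ` set ws \<subseteq> I"
  shows "fam_val g (us @ ws) = fam_val g us \<otimes> fam_val g ws"
  using assms(2)
proof (induction us)
  case Nil
  then show ?case using fam_val_closed[OF assms(1,3)] by simp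
next
  case (Cons l us)
  then have "g (fst l) \<in> carrier G" "fam_val g us \<in> carrier G"
    using assms(1) fam_val_closed[OF assms(1)] by auto
  then show ?case
    using Cons fam_val_closed[OF assms(1,3)] by (simp add: fam_val_Cons m_assoc)
qed

lemma fam_val_inv_word:
  assumes "g ` I \<subseteq> carrier G" "fst ` set ws \<subseteq> I"
  shows "fam_val g (inv_word ws) = inv (fam_val g ws)"
  using assms(2)
proof (induction ws)
  case Nil
  then show ?case by (simp add: inv_word_def)
next
  case (Cons l ws)
  have l: "g (fst l) \<in> carrier G" and w: "fam_val g ws \<in> carrier G"
    using Cons.prems assms(1) fam_val_closed[OF assms(1)] by auto
  have "fam_val g (inv_word (l # ws)) = fam_val g (inv_word ws @ [(fst l, \<not> snd l)])"
    by (simp add: inv_word_def map_prod_def split_beta)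
  also have "\<dots> = fam_val g (inv_word ws) \<otimes> fam_val g [(fst l, \<not> snd l)]"
    by (rule fam_val_append[OF assms(1)]) (use Cons.prems in \<open>auto simp: fst_set_inv_word\<close>)
  finally show ?case
    using Cons l w by (auto simp: fam_val_Cons inv_mult_group)
qed

lemma fam_val_replicate:
  assumes "g i \<in> carrier G"
  shows "fam_val g (replicate n (i, s)) = g i [^] (if s then int n else - int n)"
proof (induction n)
  case (Suc n)
  then have "fam_val g (replicate (Suc n) (i, s)) =
      g i [^] (if s then 1 else - 1 :: int) \<otimes> g i [^] (if s then int n else - int n)"
    using assms by (simp add: fam_val_Cons int_pow_neg)
  also have "\<dots> = g i [^] ((if s then 1 else - 1) + (if s then int n else - int n))"
    using assms by (simp add: int_pow_mult)
  finally show ?case by (auto simp: algebra_simps)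
qed auto

lemma fam_val_pow_word: "g i \<in> carrier G \<Longrightarrow> fam_val g (pow_word i n) = g i [^] n"
  by (auto simp: pow_word_def fam_val_replicate)

lemma generate_family:
  assumes "g ` I \<subseteq> carrier G"
  shows "generate G (g ` I) = {fam_val g ws |ws. fst ` set ws \<subseteq> I}"
proof
  show "generate G (g ` I) \<subseteq> {fam_val g ws |ws. fst ` set ws \<subseteq> I}"
  proof
    fix x assume "x \<in> generate G (g ` I)"
    then show "x \<in> {fam_val g ws |ws. fst ` set ws \<subseteq> I}"
    proof induction
      case one
      show ?case by (auto intro!: exI[of _ "[]"])
    next
      case (incl h)
      then obtain i where "i \<in> I" "h = g i" by auto
      then show ?case using assms by (auto intro!: exI[of _ "[(i, True)]"] simp: fam_val_Cons)
    next
      case (inv h)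
      then obtain i where "i \<in> I" "h = g i" by auto
      then show ?case using assms by (auto intro!: exI[of _ "[(i, False)]"] simp: fam_val_Cons)
    next
      case (eng h1 h2)
      then obtain us ws where "fst ` set us \<subseteq> I" "h1 = fam_val g us" "fst ` set ws \<subseteq> I"
        "h2 = fam_val g ws" by auto
      then show ?case
        using fam_val_append[OF assms, of us ws] by (intro CollectI exI[of _ "us @ ws"]) auto
    qed
  qed
next
  have "fam_val g ws \<in> generate G (g ` I)" if "fst ` set ws \<subseteq> I" for ws
    using that
    by (induction ws) (auto simp: fam_val_Cons intro: generate.intros)
  then show "{fam_val g ws |ws. fst ` set ws \<subseteq> I} \<subseteq> generate G (g ` I)" by auto
qed

text \<open>A letter put in front of a reduced word cancels at most once, and deleting a cancelling
  pair can only remove heights from the path. Hence a bound on the heights of any word for an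
  element survives reduction.\<close>

lemma reduce_word:
  assumes "g ` I \<subseteq> carrier G" "fst ` set ws \<subseteq> I"
  shows "\<exists>us. reduced_word us \<and> fst ` set us \<subseteq> I \<and> fam_val g us = fam_val g ws \<and>
           word_weight wt us = word_weight wt ws \<and> (\<forall>c. heights wt c us \<subseteq> heights wt c ws)"
  using assms(2)
proof (induction ws)
  case Nil
  then show ?case by (intro exI[of _ "[]"]) (simp add: reduced_word_def)
next
  case (Cons l ws)
  then obtain us where us: "reduced_word us" "fst ` set us \<subseteq> I" "fam_val g us = fam_val g ws"
      "word_weight wt us = word_weight wt ws" "\<And>c. heights wt c us \<subseteq> heights wt c ws"
    by auto
  have l: "g (fst l) \<in> carrier G" using Cons.prems assms(1) by auto
  show ?case
  proof (cases "us \<noteq> [] \<and> cancels l (hd us)")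
    case True
    then obtain vs where vs: "us = (fst l, \<not> snd l) # vs"
      by (cases us) (auto simp: cancels_def prod_eq_iff)
    have vI: "fst ` set vs \<subseteq> I" using us(2) vs by auto
    have "fam_val g vs = fam_val g (l # us)"
      using l fam_val_closed[OF assms(1) vI] by (auto simp: vs fam_val_Cons m_assoc[symmetric])
    moreover have "fam_val g (l # us) = fam_val g (l # ws)" using us by (simp add: fam_val_Cons)
    moreover have "heights wt c vs \<subseteq> heights wt c (l # ws)" for c
      using us(5)[of "c + letter_weight wt l"] by (auto simp: vs letter_weight_def)
    moreover have "word_weight wt vs = word_weight wt (l # ws)"
      using us(4) by (auto simp: vs letter_weight_def)
    ultimately show ?thesis
      using us(1) vI by (intro exI[of _ vs]) (auto simp: vs reduced_word_Cons)
  next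
    case False
    then show ?thesis
      using us Cons.prems
      by (intro exI[of _ "l # us"]) (auto simp: reduced_word_Cons fam_val_Cons)
  qed
qed

text \<open>A common first letter can be stripped. If the first letters differ, nothing cancels
  where the inverse of one word meets the other, and a nonempty reduced word with trivial value
  results.\<close>

lemma reduced_word_unique:
  assumes "free_family g I" "reduced_word us" "reduced_word ws"
    "fst ` set us \<subseteq> I" "fst ` set ws \<subseteq> I" "fam_val g us = fam_val g ws"
  shows "us = ws"
  using assms(2-)
proof (induction us arbitrary: ws)
  case Nil
  then show ?case using assms(1) unfolding free_family_def by (metis fam_val_Nil)
next
  case (Cons l us)
  have gI: "g ` I \<subseteq> carrier G" using assms(1) by (simp add: free_family_def)
  have "ws \<noteq> []"
    using assms(1) Cons.prems unfolding free_family_def by (metis fam_val_Nil list.distinct(1))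
  then obtain l' vs where ws: "ws = l' # vs" by (cases ws) auto
  show ?case
  proof (cases "l = l'")
    case True
    have "g (fst l) \<in> carrier G" "fam_val g us \<in> carrier G" "fam_val g vs \<in> carrier G"
      using gI Cons.prems ws fam_val_closed[OF gI] by auto
    then have "fam_val g us = fam_val g vs"
      using Cons.prems(5) by (auto simp: ws True fam_val_Cons split: if_splits)
    then show ?thesis using Cons ws True by (auto simp: reduced_word_Cons)
  next
    case False
    let ?w = "inv_word (l # us) @ ws"
    have "last (inv_word (l # us)) = (fst l, \<not> snd l)" "inv_word (l # us) \<noteq> []"
      by (auto simp: inv_word_def map_prod_def split_beta)
    then have "reduced_word ?w"
      using reduced_word_inv_word[OF Cons.prems(1)] Cons.prems(2) False
      unfolding reduced_word_iff successively_append_iff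
      by (auto simp: ws cancels_def prod_eq_iff)
    moreover have "fst ` set ?w \<subseteq> I"
      using Cons.prems fst_set_inv_word[of "l # us"] by (simp add: image_Un)
    moreover have "fam_val g ?w = \<one>"
      using fam_val_append[OF gI, of "inv_word (l # us)" ws] fst_set_inv_word[of "l # us"]
        fam_val_inv_word[OF gI Cons.prems(3)] Cons.prems fam_val_closed[OF gI, of ws]
      by auto
    ultimately show ?thesis
      using assms(1) ws by (auto simp: free_family_def)
  qed
qed

lemma free_family_inj_on:
  assumes "free_family g I"
  shows "inj_on g I"
proof
  fix i j assume "i \<in> I" "j \<in> I" "g i = g j"
  then have "[(i, True)] = [(j, True)]"
    by (intro reduced_word_unique[OF assms]) (auto simp: fam_val_Cons reduced_word_def)
  then show "i = j" by simp
qed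

text \<open>Words over the values lift along \<open>inv_into\<close>; a cancellation in the lift
  would also be one below, so reducedness lifts too. Injectivity gives the cardinality.\<close>

lemma free_family_has_rank:
  assumes "free_family g I" "finite I"
  shows "has_rank G (generate G (g ` I)) (card I)"
proof -
  have inj: "inj_on g I" using free_family_inj_on assms(1) .
  have "word_val G ws \<noteq> \<one>"
    if ws: "ws \<noteq> []" "set (map fst ws) \<subseteq> g ` I" "reduced_word ws" for ws
  proof -
    define vs where "vs = map (map_prod (inv_into I g) id) ws"
    have ws_vs: "ws = map (map_prod g id) vs"
      using ws(2) by (auto simp: vs_def map_prod_def split_beta f_inv_into_f subset_iff
          intro!: map_idI[symmetric])
    have vI: "fst ` set vs \<subseteq> I"
      using ws(2) by (force simp: vs_def intro!: inv_into_into)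
    have "reduced_word vs"
      using ws(3) by (auto simp: ws_vs reduced_word_def)
    then show ?thesis
      using assms(1) vI ws(1) unfolding free_family_def fam_val_def ws_vs by auto
  qed
  then have "free_basis G (g ` I) (generate G (g ` I))"
    using assms(1) by (auto simp: free_basis_def free_family_def)
  then show ?thesis
    using assms(2) card_image[OF inj] unfolding has_rank_def by blast
qed

end

section \<open>Normal forms over a conjugate family\<close>

text \<open>A family of elements \<open>t\<^sup>A m\<^sup>N t\<^sup>-\<^sup>B\<close>, where \<open>t\<close> and \<open>m\<close> belong to a free family. The last two
  assumptions keep \<open>m\<^sup>N\<close> from cancelling against the neighbouring factors.\<close>

locale conjugate_family = group G for G (structure) +
  fixes g :: "'i \<Rightarrow> 'a" and I :: "'i set" and t :: 'i
    and f :: "'j \<Rightarrow> 'a" and J :: "'j set"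
    and A B :: "'j \<Rightarrow> int" and M :: "'j \<Rightarrow> 'i" and N :: "'j \<Rightarrow> nat"
  assumes free: "free_family g I"
    and t: "t \<in> I"
    and M: "j \<in> J \<Longrightarrow> M j \<in> I"
    and N: "j \<in> J \<Longrightarrow> 0 < N j"
    and f_eq: "j \<in> J \<Longrightarrow> f j = g t [^] A j \<otimes> g (M j) [^] int (N j) \<otimes> g t [^] (- B j)"
    and separated: "\<lbrakk>j \<in> J; j' \<in> J; j \<noteq> j'; M j = M j'\<rbrakk> \<Longrightarrow> A j \<noteq> A j' \<and> B j \<noteq> B j'"
    and dominant: "\<lbrakk>j \<in> J; j' \<in> J; M j = t\<rbrakk> \<Longrightarrow>
      B j \<le> 0 \<and> 0 \<le> A j \<and> A j' \<in> {B j..A j} \<and> B j' \<in> {B j..A j}"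
begin

text \<open>An inverse letter reads the product \<open>t^A m^N t^-B\<close> backwards, so
  \<open>A\<close> and \<open>B\<close> change places.\<close>

definition lft :: "'j \<times> bool \<Rightarrow> int" where
  "lft l = (if snd l then A (fst l) else B (fst l))"

definition rgt :: "'j \<times> bool \<Rightarrow> int" where
  "rgt l = (if snd l then B (fst l) else A (fst l))"

definition mid :: "'j \<times> bool \<Rightarrow> ('i \<times> bool) list" where
  "mid l = replicate (N (fst l)) (M (fst l), snd l)"

text \<open>The weight that \<open>f j\<close> inherits when \<open>t\<close> has weight 0.\<close>

definition weight :: "('i \<Rightarrow> int) \<Rightarrow> 'j \<Rightarrow> int" where
  "weight wt j = int (N j) * wt (M j)"

lemma g_carrier: "g ` I \<subseteq> carrier G"
  using free by (simp add: free_family_def)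

lemma gt_carrier: "g t \<in> carrier G"
  using g_carrier t by auto

lemma f_carrier: "f ` J \<subseteq> carrier G"
  using g_carrier t M by (auto simp: f_eq image_subset_iff)

lemma fst_set_mid: "fst l \<in> J \<Longrightarrow> fst ` set (mid l) \<subseteq> I"
  by (auto simp: mid_def M)

lemma letter_weight_mid: "word_weight wt (mid l) = letter_weight (weight wt) l"
  by (simp add: mid_def letter_weight_def weight_def)

lemma fam_val_letter:
  assumes "fst l \<in> J"
  shows "(if snd l then f (fst l) else inv (f (fst l))) =
    g t [^] lft l \<otimes> fam_val g (mid l) \<otimes> g t [^] (- rgt l)"
  using assms M[OF assms] g_carrier t
  by (auto simp: f_eq lft_def rgt_def mid_def fam_val_replicate inv_mult_group int_pow_neg
      m_assoc image_subset_iff)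

text \<open>\<open>d\<close> is the exponent of \<open>t\<close> left between \<open>mid l\<close>
  and what follows. If it vanishes the two meet directly, hence the case split in the last
  hypothesis.\<close>

lemma letter_prefix_reduced:
  assumes "fst l \<in> J" "reduced_word ws"
    and "d = 0 \<or> \<not> cancels (M (fst l), snd l) (t, 0 \<le> d)"
    and "ws = [] \<or> (if d = 0 then \<not> cancels (M (fst l), snd l) (hd ws)
                     else \<not> cancels (t, 0 \<le> d) (hd ws))"
  shows "reduced_word (pow_word t (lft l) @ mid l @ pow_word t d @ ws)"
proof -
  have "lft l = 0 \<or> \<not> cancels (t, 0 \<le> lft l) (M (fst l), snd l)"
    using dominant[OF assms(1) assms(1)] by (auto simp: cancels_def lft_def)
  then show ?thesis
    using assms N[OF assms(1)]
    by (auto simp: reduced_word_pow_word_append mid_def reduced_word_replicate_append hd_append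
        pow_word_def hd_replicate)
qed

text \<open>Powers of \<open>t\<close> between neighbours merge while the \<open>mid\<close> blocks
  survive; so if \<open>wt t = 0\<close>, the path of the normal form visits every height of the
  original path. \<open>mid l\<close> stays visible in the statement so that the induction can merge
  a further power of \<open>t\<close> in front of it.\<close>

lemma normal_form:
  assumes "reduced_word (l # ws)" "fst ` set (l # ws) \<subseteq> J"
  shows "\<exists>vs. reduced_word (pow_word t (lft l) @ mid l @ vs) \<and> fst ` set vs \<subseteq> I \<and>
    fam_val f (l # ws) = g t [^] lft l \<otimes> fam_val g (mid l @ vs) \<and>
    (wt t = 0 \<longrightarrow>
      letter_weight (weight wt) l + word_weight wt vs = word_weight (weight wt) (l # ws) \<and>
      (\<forall>c. heights (weight wt) c (l # ws) \<subseteq> heights wt c (mid l @ vs)))"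
  using assms
proof (induction ws arbitrary: l)
  case Nil
  have l: "fst l \<in> J" using Nil by auto
  have "rgt l = 0 \<or> \<not> cancels (M (fst l), snd l) (t, 0 \<le> - rgt l)"
    using dominant[OF l l] by (auto simp: cancels_def rgt_def)
  then have "reduced_word (pow_word t (lft l) @ mid l @ pow_word t (- rgt l) @ [])"
    by (intro letter_prefix_reduced l) (auto simp: reduced_word_def)
  moreover have "fam_val f [l] = g t [^] lft l \<otimes> fam_val g (mid l @ pow_word t (- rgt l))"
  proof -
    have "fam_val g (mid l @ pow_word t (- rgt l)) = fam_val g (mid l) \<otimes> g t [^] (- rgt l)"
      using fam_val_append[OF g_carrier fst_set_mid[OF l], of "pow_word t (- rgt l)"]
        fst_set_pow_word[of t "- rgt l"] t gt_carrier
      by (auto simp: fam_val_pow_word)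
    then show ?thesis
      using fam_val_letter[OF l] gt_carrier fam_val_closed[OF g_carrier fst_set_mid[OF l]]
        f_carrier l
      by (auto simp: fam_val_Cons m_assoc)
  qed
  moreover have "heights (weight wt) c [l] \<subseteq> heights wt c (mid l @ pow_word t (- rgt l))" for c
    by (auto simp: heights_append start_in_heights letter_weight_mid)
  ultimately show ?case
    using fst_set_pow_word[of t "- rgt l"] t
    by (intro exI[of _ "pow_word t (- rgt l)"]) auto
next
  case (Cons l' ws)
  have l: "fst l \<in> J" and l': "fst l' \<in> J" using Cons.prems by auto
  have nc: "\<not> cancels l l'" using Cons.prems by (auto simp: reduced_word_Cons)
  obtain vs where vs: "reduced_word (pow_word t (lft l') @ mid l' @ vs)" "fst ` set vs \<subseteq> I"
    "fam_val f (l' # ws) = g t [^] lft l' \<otimes> fam_val g (mid l' @ vs)"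
    "wt t = 0 \<Longrightarrow> letter_weight (weight wt) l' + word_weight wt vs = word_weight (weight wt) (l' # ws)"
    "wt t = 0 \<Longrightarrow> heights (weight wt) c (l' # ws) \<subseteq> heights wt c (mid l' @ vs)" for c
    using Cons.IH[of l'] Cons.prems by (auto simp: reduced_word_Cons)
  define d where "d = lft l' - rgt l"
  define us where "us = mid l' @ vs"
  have hd_us: "us \<noteq> []" "hd us = (M (fst l'), snd l')"
    using N[OF l'] by (auto simp: us_def mid_def hd_append)
  have us: "fst ` set us \<subseteq> I" using vs(2) fst_set_mid[OF l'] by (auto simp: us_def)
  have pI: "fst ` set (pow_word t d) \<subseteq> I" using fst_set_pow_word[of t d] t by auto
  have "reduced_word us" using vs(1) by (simp add: reduced_word_pow_word_append us_def)
  \<comment> \<open>If a middle letter is \<open>t\<close> itself, \<open>dominant\<close> gives a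
    nonzero \<open>d\<close> the sign of the block it touches.\<close>
  moreover have "d = 0 \<or> \<not> cancels (M (fst l), snd l) (t, 0 \<le> d)"
    using dominant[OF l l'] by (auto simp: cancels_def d_def lft_def rgt_def)
  moreover have "d = 0 \<or> \<not> cancels (t, 0 \<le> d) (hd us)"
    using dominant[OF l' l] by (auto simp: hd_us cancels_def d_def lft_def rgt_def)
  \<comment> \<open>For distinct indices with the same middle letter and opposite signs,
    \<open>d\<close> is a difference of two values of \<open>A\<close> or of two values of
    \<open>B\<close>, nonzero by \<open>separated\<close>.\<close>
  moreover have "d = 0 \<longrightarrow> \<not> cancels (M (fst l), snd l) (hd us)"
    using separated[OF l l'] nc
    by (cases "fst l = fst l'") (auto simp: hd_us cancels_def d_def lft_def rgt_def)
  ultimately have "reduced_word (pow_word t (lft l) @ mid l @ pow_word t d @ us)"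
    by (intro letter_prefix_reduced l) auto
  moreover have "fam_val f (l # l' # ws) = g t [^] lft l \<otimes> fam_val g (mid l @ pow_word t d @ us)"
  proof -
    have v: "fam_val g us \<in> carrier G" "fam_val g (mid l) \<in> carrier G"
      using fam_val_closed[OF g_carrier] us fst_set_mid[OF l] by auto
    have "fam_val g (mid l @ pow_word t d @ us) = fam_val g (mid l) \<otimes> (g t [^] d \<otimes> fam_val g us)"
      using fam_val_append[OF g_carrier fst_set_mid[OF l], of "pow_word t d @ us"]
        fam_val_append[OF g_carrier pI us] pI us fam_val_pow_word[where g=g, OF gt_carrier]
      by auto
    also have "g t [^] d = g t [^] (- rgt l) \<otimes> g t [^] lft l'"
      using gt_carrier by (simp add: int_pow_mult[symmetric] d_def)
    finally show ?thesis
      using fam_val_letter[OF l] vs(3) v gt_carrier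
      unfolding fam_val_Cons[of f l] by (simp add: us_def[symmetric] m_assoc)
  qed
  moreover have "heights (weight wt) c (l # l' # ws) \<subseteq> heights wt c (mid l @ pow_word t d @ us)"
    if "wt t = 0" for c
    using vs(5)[OF that, of "c + letter_weight (weight wt) l"] that
    by (auto simp: heights_append start_in_heights letter_weight_mid us_def)
  moreover have "letter_weight (weight wt) l + word_weight wt (pow_word t d @ us) =
      word_weight (weight wt) (l # l' # ws)" if "wt t = 0"
    using vs(4) that by (simp add: us_def letter_weight_mid)
  ultimately show ?case
    using us pI by (intro exI[of _ "pow_word t d @ us"]) auto
qed

lemma normal_form_weights:
  assumes "reduced_word ws" "fst ` set ws \<subseteq> J" "wt t = 0"
  shows "\<exists>vs. reduced_word vs \<and> fst ` set vs \<subseteq> I \<and> fam_val f ws = fam_val g vs \<and>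
    word_weight wt vs = word_weight (weight wt) ws \<and>
    heights (weight wt) c ws \<subseteq> heights wt c vs \<and> (ws \<noteq> [] \<longrightarrow> vs \<noteq> [])"
proof (cases ws)
  case Nil
  then show ?thesis by (intro exI[of _ "[]"]) (auto simp: reduced_word_def)
next
  case (Cons l ws')
  have l: "fst l \<in> J" using assms Cons by auto
  obtain vs where vs: "reduced_word (pow_word t (lft l) @ mid l @ vs)" "fst ` set vs \<subseteq> I"
    "fam_val f ws = g t [^] lft l \<otimes> fam_val g (mid l @ vs)"
    "letter_weight (weight wt) l + word_weight wt vs = word_weight (weight wt) ws"
    "heights (weight wt) c ws \<subseteq> heights wt c (mid l @ vs)"
    using normal_form[of l ws' wt] assms Cons by auto
  let ?v = "pow_word t (lft l) @ mid l @ vs"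
  have pI: "fst ` set (pow_word t (lft l)) \<subseteq> I" using fst_set_pow_word[of t "lft l"] t by auto
  have mI: "fst ` set (mid l @ vs) \<subseteq> I" using fst_set_mid[OF l] vs(2) by auto
  have "fam_val f ws = fam_val g ?v"
    using vs(3) fam_val_append[OF g_carrier pI mI] fam_val_pow_word[where g=g, OF gt_carrier] by simp
  moreover have "word_weight wt ?v = word_weight (weight wt) ws"
    using vs(4) assms(3) by (simp add: letter_weight_mid)
  moreover have "heights (weight wt) c ws \<subseteq> heights wt c ?v"
    using vs(5) assms(3) by (auto simp: heights_append)
  moreover have "?v \<noteq> []" using N[OF l] by (simp add: mid_def)
  moreover have "fst ` set ?v \<subseteq> I" using pI mI by auto
  ultimately show ?thesis using vs(1) by blast
qed

text \<open>The zero weight satisfies \<open>wt t = 0\<close>, and a nonempty reduced word has a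
  nonempty normal form.\<close>

lemma free_family: "free_family f J"
proof -
  have "fam_val f ws \<noteq> \<one>" if ws: "ws \<noteq> []" "fst ` set ws \<subseteq> J" "reduced_word ws" for ws
  proof -
    obtain vs where "reduced_word vs" "fst ` set vs \<subseteq> I" "fam_val f ws = fam_val g vs" "vs \<noteq> []"
      using normal_form_weights[OF ws(3,2), of "\<lambda>_. 0" 0] ws(1) by auto
    then show ?thesis using free by (auto simp: free_family_def)
  qed
  then show ?thesis using f_carrier by (auto simp: free_family_def)
qed

end

section \<open>Powers of conjugates\<close>

lemma (in group) conjugate_nat_pow:
  assumes "x \<in> carrier G" "y \<in> carrier G"
  shows "(x \<otimes> y \<otimes> inv x) [^] (n::nat) = x \<otimes> y [^] n \<otimes> inv x"
proof (induction n)
  case (Suc n)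
  have "(x \<otimes> y \<otimes> inv x) [^] Suc n = (x \<otimes> y [^] n \<otimes> inv x) \<otimes> (x \<otimes> y \<otimes> inv x)"
    by (simp only: nat_pow_Suc Suc)
  also have "\<dots> = x \<otimes> (y [^] n \<otimes> ((inv x \<otimes> x) \<otimes> (y \<otimes> inv x)))"
    by (simp only: m_assoc m_closed nat_pow_closed inv_closed assms)
  also have "\<dots> = x \<otimes> y [^] Suc n \<otimes> inv x"
    by (simp only: l_inv l_one nat_pow_Suc m_assoc m_closed nat_pow_closed inv_closed assms)
  finally show ?case .
qed (use assms in simp)

lemma (in group) conjugate_int_pow:
  assumes "x \<in> carrier G" "y \<in> carrier G"
  shows "(x \<otimes> y \<otimes> inv x) [^] (n::int) = x \<otimes> y [^] n \<otimes> inv x"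
proof (cases "n < 0")
  case True
  have "inv (x \<otimes> y [^] nat (- n) \<otimes> inv x) = x \<otimes> inv (y [^] nat (- n)) \<otimes> inv x"
    using assms by (simp add: inv_mult_group m_assoc)
  then show ?thesis
    using True by (simp only: int_pow_def2 conjugate_nat_pow[OF assms] if_True)
next
  case False
  then show ?thesis
    by (simp only: int_pow_def2 conjugate_nat_pow[OF assms] if_False)
qed

section \<open>The subgroups \<open>H\<close> and \<open>K\<close>, their intersection and their
  join\<close>

locale rank_construction = group G for G (structure) +
  fixes b :: "nat \<Rightarrow> 'a" and p q h k :: nat and n :: "nat \<Rightarrow> nat"
  assumes free_b: "free_family b {..<h + k - p - q}"
    and p: "p < h" and q: "q < k"
    and n_0: "n 0 = 1"
    and n_pos: "j \<noteq> q \<Longrightarrow> n j \<noteq> 0"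
    and n_extra: "q < j \<Longrightarrow> n j = p + 1"
begin

text \<open>\<open>b 0\<close> is x, \<open>b 1\<close> is y, E consists of \<open>b 2\<close> to
  \<open>b (h - p)\<close>, and E' of the remaining letters; the shift \<open>i - p + 1\<close>
  lists E.\<close>

definition H_gen :: "nat \<Rightarrow> 'a" where
  "H_gen i = (if i \<le> p then b 0 [^] int i \<otimes> b 1 \<otimes> b 0 [^] (- int i) else b (i - p + 1))"

text \<open>With \<open>K_lft\<close>, \<open>K_rgt\<close> and \<open>K_exp\<close> this presents
  the generators of \<open>K\<close> as a conjugate family over y. The shift
  \<open>j + h - p - q\<close> lists E' from index \<open>h - p + 1\<close> on.\<close>

definition K_mid :: "nat \<Rightarrow> nat" where
  "K_mid j = (if q < j then j + h - p - q else if n j = 0 then 1 else 0)"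

definition K_lft :: "nat \<Rightarrow> int" where
  "K_lft j = (if q < j then 0 else int j)"

definition K_rgt :: "nat \<Rightarrow> int" where
  "K_rgt j = (if q < j then 0 else if n j = 0 then - int j else int j)"

definition K_exp :: "nat \<Rightarrow> nat" where
  "K_exp j = (if q < j \<or> n j = 0 then 1 else n j)"

text \<open>For \<open>n j = 0\<close> this is \<open>b 1 [^] (2 * q + 1)\<close>: a power of \<open>b 1\<close> high enough not to be absorbed
  by the conjugating powers of the neighbouring generators.\<close>

definition K_gen :: "nat \<Rightarrow> 'a" where
  "K_gen j = b 1 [^] K_lft j \<otimes> b (K_mid j) [^] int (K_exp j) \<otimes> b 1 [^] (- K_rgt j)"

text \<open>Up the spanning tree to height \<open>i\<close>, along the \<open>j\<close>-edge and
  back down the tree: the standard loop belonging to a non-tree edge. \<open>U_index\<close>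
  collects the non-tree edges inside the strip.\<close>

definition U_gen :: "nat \<times> nat \<Rightarrow> 'a" where
  "U_gen = (\<lambda>(j, i). b 0 [^] int i \<otimes> K_gen j \<otimes> b 0 [^] (- int (i + n j)))"

definition U_index :: "(nat \<times> nat) set" where
  "U_index = (SIGMA j:{1..<k}. {i. i + n j \<le> p})"

definition wt :: "nat \<Rightarrow> int" where
  "wt i = (if i = 0 then 1 else if i \<le> h - p then 0 else int p + 1)"

definition H :: "'a set" where "H = generate G (H_gen ` {..<h})"
definition K :: "'a set" where "K = generate G (K_gen ` {..<k})"

lemma b_image: "b ` {..<h + k - p - q} \<subseteq> carrier G"
  using free_b by (simp add: free_family_def)

lemma b_carrier [simp]: "i < h + k - p - q \<Longrightarrow> b i \<in> carrier G"
  using b_image by auto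

lemma b01_carrier [simp]: "b 0 \<in> carrier G" "b 1 \<in> carrier G" "b (Suc 0) \<in> carrier G"
  using p q by auto

text \<open>The conjugating letter x is never a middle letter, so \<open>dominant\<close> holds
  vacuously; generators sharing the middle letter y have distinct exponents.\<close>

lemma H_family:
  "conjugate_family G b {..<h + k - p - q} 0 H_gen {..<h}
     (\<lambda>i. if i \<le> p then int i else 0) (\<lambda>i. if i \<le> p then int i else 0)
     (\<lambda>i. if i \<le> p then 1 else i - p + 1) (\<lambda>_. 1)"
  by unfold_locales (use free_b p q in \<open>auto simp: H_gen_def split: if_splits\<close>)

text \<open>The conjugating letter y is a middle letter only for \<open>j = q\<close> with
  \<open>n q = 0\<close>; the interval from \<open>- q\<close> to \<open>q\<close> then contains all
  the exponents.\<close>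

lemma K_family:
  "conjugate_family G b {..<h + k - p - q} 1 K_gen {..<k} K_lft K_rgt K_mid K_exp"
proof unfold_locales
  fix j j' assume "j \<in> {..<k}" "j' \<in> {..<k}" "K_mid j = 1"
  then have "j = q" using n_pos[of j] p by (auto simp: K_mid_def split: if_splits)
  then show "K_rgt j \<le> 0 \<and> 0 \<le> K_lft j \<and> K_lft j' \<in> {K_rgt j..K_lft j} \<and>
      K_rgt j' \<in> {K_rgt j..K_lft j}"
    using \<open>K_mid j = 1\<close> by (auto simp: K_mid_def K_rgt_def K_lft_def split: if_splits)
next
  fix j j' assume *: "j \<in> {..<k}" "j' \<in> {..<k}" "j \<noteq> j'" "K_mid j = K_mid j'"
  then show "K_lft j \<noteq> K_lft j' \<and> K_rgt j \<noteq> K_rgt j'"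
    using n_pos[of j] n_pos[of j'] p
    by (auto simp: K_mid_def K_rgt_def K_lft_def split: if_splits)
qed (use free_b p q in \<open>auto simp: K_gen_def K_mid_def K_exp_def\<close>)

interpretation H: conjugate_family G b "{..<h + k - p - q}" 0 H_gen "{..<h}"
  "\<lambda>i. if i \<le> p then int i else 0" "\<lambda>i. if i \<le> p then int i else 0"
  "\<lambda>i. if i \<le> p then 1 else i - p + 1" "\<lambda>_. 1"
  by (rule H_family)

interpretation K: conjugate_family G b "{..<h + k - p - q}" 1 K_gen "{..<k}" K_lft K_rgt K_mid K_exp
  by (rule K_family)

lemma wt_1: "wt 1 = 0"
  using p by (simp add: wt_def)

text \<open>The middle blocks are a power of x, a letter of E' or, for \<open>n j = 0\<close>, the
  letter y; in each case the weight is the length of the \<open>j\<close>-edge.\<close>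

lemma K_weight: "K.weight wt j = int (n j)"
  using n_extra[of j] p by (auto simp: K.weight_def wt_def K_exp_def K_mid_def)

lemma K_gen_0: "K_gen 0 = b 0"
  using n_0 by (simp add: K_gen_def K_lft_def K_rgt_def K_mid_def K_exp_def)

lemma K_gen_carrier [simp]: "j < k \<Longrightarrow> K_gen j \<in> carrier G"
  using K.f_carrier by auto

text \<open>The criterion for conjugate families is applied a second time, now over the generators
  of \<open>K\<close>, with x = \<open>K_gen 0\<close> as conjugating letter.\<close>

lemma U_family:
  "conjugate_family G K_gen {..<k} 0 U_gen U_index
     (\<lambda>(j, i). int i) (\<lambda>(j, i). int (i + n j)) fst (\<lambda>_. 1)"
  by unfold_locales
    (use K.free_family q in \<open>auto simp: U_index_def U_gen_def K_gen_0\<close>)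

lemma subgroup_H: "subgroup H G"
  unfolding H_def by (rule generate_is_subgroup) (rule H.f_carrier)

lemma subgroup_K: "subgroup K G"
  unfolding K_def by (rule generate_is_subgroup) (rule K.f_carrier)

lemma H_gen_in_H: "i < h \<Longrightarrow> H_gen i \<in> H"
  unfolding H_def by (auto intro: generate.incl)

lemma K_gen_in_K: "j < k \<Longrightarrow> K_gen j \<in> K"
  unfolding K_def by (auto intro: generate.incl)

lemma rank_H: "has_rank G H h"
  using free_family_has_rank[OF H.free_family] by (simp add: H_def)

lemma rank_K: "has_rank G K k"
  using free_family_has_rank[OF K.free_family] by (simp add: K_def)

text \<open>The path climbs to height \<open>i\<close> by x, takes a step of weight 0 and descends
  again.\<close>

lemma H_gen_word:
  assumes "i < h"
  shows "\<exists>vs. fst ` set vs \<subseteq> {..<h + k - p - q} \<and>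
    fam_val b vs = (if s then H_gen i else inv (H_gen i)) \<and>
    word_weight wt vs = 0 \<and> heights wt 0 vs \<subseteq> {0..int p}"
proof (cases "i \<le> p")
  case True
  let ?vs = "pow_word 0 (int i) @ (1, s) # pow_word 0 (- int i)"
  have I: "fst ` set (pow_word (0::nat) m) \<subseteq> {..<h + k - p - q}" for m
    using fst_set_pow_word[of "0::nat" m] p q by auto
  have I1: "fst ` set ((1, s) # pow_word 0 (- int i)) \<subseteq> {..<h + k - p - q}"
    using I[of "- int i"] p q by auto
  have "fam_val b ?vs = b 0 [^] int i \<otimes> ((if s then b 1 else inv (b 1)) \<otimes> b 0 [^] (- int i))"
    using fam_val_append[OF b_image I I1] by (simp add: fam_val_pow_word fam_val_Cons)
  also have "\<dots> = (if s then H_gen i else inv (H_gen i))"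
    using True by (simp add: H_gen_def inv_mult_group m_assoc int_pow_neg)
  finally have "fam_val b ?vs = (if s then H_gen i else inv (H_gen i))" .
  moreover have "word_weight wt ?vs = 0"
    using p by (simp add: wt_def letter_weight_def)
  moreover have "heights wt 0 ?vs \<subseteq> {0..int p}"
    using p True
    by (auto simp: heights_append pow_word_def heights_replicate wt_def letter_weight_def)
  moreover have "fst ` set ?vs \<subseteq> {..<h + k - p - q}"
    using I[of "int i"] I1 by auto
  ultimately show ?thesis by blast
next
  case False
  then show ?thesis
    using assms p q
    by (intro exI[of _ "[(i - p + 1, s)]"])
      (auto simp: fam_val_Cons H_gen_def wt_def letter_weight_def)
qed

text \<open>Closed paths at height 0 inside the strip can be concatenated. The word need not be
  reduced, since \<open>reduce_word\<close> only shrinks its set of heights.\<close>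

lemma H_bounded_word:
  assumes "w \<in> H"
  shows "\<exists>vs. fst ` set vs \<subseteq> {..<h + k - p - q} \<and> fam_val b vs = w \<and>
    word_weight wt vs = 0 \<and> heights wt 0 vs \<subseteq> {0..int p}"
  using assms unfolding H_def
proof induction
  case one
  show ?case by (intro exI[of _ "[]"]) auto
next
  case (incl w)
  then show ?case using H_gen_word[of _ True] by auto
next
  case (inv w)
  then show ?case using H_gen_word[of _ False] by auto
next
  case (eng w1 w2)
  then obtain us vs where
    "fst ` set us \<subseteq> {..<h + k - p - q}" "fam_val b us = w1"
    "word_weight wt us = 0" "heights wt 0 us \<subseteq> {0..int p}"
    "fst ` set vs \<subseteq> {..<h + k - p - q}" "fam_val b vs = w2"
    "word_weight wt vs = 0" "heights wt 0 vs \<subseteq> {0..int p}"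
    by blast
  then show ?case
    using fam_val_append[OF b_image, of us vs]
    by (intro exI[of _ "us @ vs"]) (simp add: heights_append image_Un)
qed

lemma U_gen_in_K:
  assumes "u \<in> U_index"
  shows "U_gen u \<in> K"
proof -
  obtain j i where u: "u = (j, i)" "j < k" using assms by (auto simp: U_index_def)
  have "b 0 [^] m \<in> K" for m :: int
    using subgroup_int_pow_closed[OF subgroup_K] K_gen_in_K[of 0] K_gen_0 q by simp
  then show ?thesis
    using K_gen_in_K[OF u(2)] subgroup.m_closed[OF subgroup_K] by (simp add: u U_gen_def)
qed

lemma conjugate_b1_in_H:
  assumes "i \<le> p"
  shows "b 0 [^] int i \<otimes> b 1 [^] (m::int) \<otimes> b 0 [^] (- int i) \<in> H"
proof -
  have "H_gen i \<in> H" using assms p by (intro H_gen_in_H) simp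
  then have "H_gen i [^] m \<in> H" by (rule subgroup_int_pow_closed[OF subgroup_H])
  then show ?thesis
    using assms conjugate_int_pow[of "b 0 [^] int i" "b 1" m]
    by (simp add: H_gen_def int_pow_neg)
qed

text \<open>For \<open>n j = m > 0\<close>, the generator is the product of the conjugate of
  \<open>y^j\<close> by \<open>x^i\<close> and the conjugate of \<open>y^-j\<close> by
  \<open>x^(i+m)\<close>; both conjugating exponents lie in the strip.\<close>

lemma U_gen_in_H:
  assumes "u \<in> U_index"
  shows "U_gen u \<in> H"
proof -
  obtain j i where u: "u = (j, i)" "j < k" "i + n j \<le> p" using assms by (auto simp: U_index_def)
  \<comment> \<open>An edge from a letter of E' has length \<open>p + 1\<close> and does not fit
    into the strip.\<close>
  have j: "j \<le> q" using n_extra[of j] u(3) by (cases "j \<le> q") auto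
  let ?l = "b 0 [^] int i \<otimes> b 1 [^] int j \<otimes> b 0 [^] (- int i)"
  show ?thesis
  proof (cases "n j = 0")
    case True
    have "U_gen u = b 0 [^] int i \<otimes> b 1 [^] (2 * int j + 1) \<otimes> b 0 [^] (- int i)"
    proof -
      have "K_gen j = b 1 [^] int j \<otimes> b 1 [^] (1::int) \<otimes> b 1 [^] int j"
        using True j by (simp add: K_gen_def K_lft_def K_rgt_def K_mid_def K_exp_def)
      also have "\<dots> = b 1 [^] (int j + 1 + int j)"
        by (simp only: int_pow_mult b01_carrier)
      finally show ?thesis using True by (simp add: u U_gen_def algebra_simps)
    qed
    then show ?thesis using conjugate_b1_in_H[of i] u(3) by simp
  next
    case False
    let ?r = "b 0 [^] int (i + n j) \<otimes> b 1 [^] (- int j) \<otimes> b 0 [^] (- int (i + n j))"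
    have "?l \<otimes> ?r = b 0 [^] int i \<otimes> b 1 [^] int j \<otimes> (b 0 [^] (- int i) \<otimes> b 0 [^] int (i + n j))
        \<otimes> b 1 [^] (- int j) \<otimes> b 0 [^] (- int (i + n j))"
      by (simp add: m_assoc)
    also have "b 0 [^] (- int i) \<otimes> b 0 [^] int (i + n j) = b 0 [^] int (n j)"
      by (simp add: int_pow_mult[symmetric])
    finally have "U_gen u = ?l \<otimes> ?r"
      using False j
      by (simp add: u U_gen_def K_gen_def K_lft_def K_rgt_def K_mid_def K_exp_def m_assoc)
    moreover have "?l \<in> H" using conjugate_b1_in_H[of i "int j"] u(3) by simp
    moreover have "?r \<in> H" using conjugate_b1_in_H[of "i + n j" "- int j"] u(3) by simp
    ultimately show ?thesis using subgroup.m_closed[OF subgroup_H] by simp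
  qed
qed

text \<open>Each letter z, leading from height \<open>c\<close> to \<open>c'\<close>, is replaced by
  \<open>x^c z x^-c'\<close>; these factors telescope, and each is trivial, a \<open>U_gen\<close>
  or the inverse of one.\<close>

lemma bounded_word_in_U:
  assumes "fst ` set ws \<subseteq> {..<k}" "heights (\<lambda>j. int (n j)) c ws \<subseteq> {0..int p}"
  shows "b 0 [^] c \<otimes> fam_val K_gen ws \<otimes> b 0 [^] (- (c + word_weight (\<lambda>j. int (n j)) ws))
    \<in> generate G (U_gen ` U_index)"
  using assms
proof (induction ws arbitrary: c)
  case Nil
  then show ?case by (simp add: int_pow_mult[symmetric] generate.one)
next
  case (Cons l ws)
  let ?W = "\<lambda>j. int (n j)" and ?U = "generate G (U_gen ` U_index)"
  have sub: "subgroup ?U G"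
    by (rule generate_is_subgroup) (rule conjugate_family.f_carrier[OF U_family])
  define j where "j = fst l"
  define c' where "c' = c + letter_weight ?W l"
  define z where "z = (if snd l then K_gen j else inv (K_gen j))"
  have j: "j < k" and c: "0 \<le> c" "c \<le> int p" and c': "0 \<le> c'" "c' \<le> int p"
    using Cons.prems start_in_heights[of c' ?W ws] by (auto simp: j_def c'_def)
  have z: "z \<in> carrier G" using j by (simp add: z_def)
  have w: "fam_val K_gen ws \<in> carrier G"
    using fam_val_closed[OF K.f_carrier] Cons.prems by auto
  have "b 0 [^] c \<otimes> z \<otimes> b 0 [^] (- c') \<in> ?U"
  proof (cases "j = 0")
    case True
    \<comment> \<open>A 0-edge belongs to the spanning tree, so its factor is trivial.\<close>
    have "z = b 0 [^] (c' - c)"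
      using True n_0 by (simp add: z_def c'_def letter_weight_def j_def K_gen_0 int_pow_neg)
    then have "b 0 [^] c \<otimes> z \<otimes> b 0 [^] (- c') = \<one>"
      by (simp add: int_pow_mult[symmetric])
    then show ?thesis by (simp add: generate.one)
  next
    case False
    show ?thesis
    proof (cases "snd l")
      case True
      have "(j, nat c) \<in> U_index"
        using c c' j False True by (auto simp: U_index_def c'_def letter_weight_def j_def)
      then have "U_gen (j, nat c) \<in> ?U" by (auto intro: generate.incl)
      then show ?thesis
        using c True by (simp add: U_gen_def z_def c'_def letter_weight_def j_def)
    next
      case sgn: False
      \<comment> \<open>An inverse letter traverses its edge backwards, so the edge starts at
        \<open>c'\<close>.\<close>
      have "(j, nat c') \<in> U_index"
        using c c' j False sgn by (auto simp: U_index_def c'_def letter_weight_def j_def)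
      then have "inv (U_gen (j, nat c')) \<in> ?U" by (auto intro: generate.inv)
      moreover have "inv (U_gen (j, nat c')) = b 0 [^] c \<otimes> z \<otimes> b 0 [^] (- c')"
      proof -
        have "c = int (nat c' + n j)"
          using c' sgn by (simp add: c'_def letter_weight_def j_def)
        then have "U_gen (j, nat c') = b 0 [^] c' \<otimes> K_gen j \<otimes> b 0 [^] (- c)"
          using c' by (simp only: U_gen_def prod.case) simp
        then show ?thesis
          using sgn j by (simp add: z_def inv_mult_group int_pow_neg m_assoc)
      qed
      ultimately show ?thesis by simp
    qed
  qed
  moreover have "b 0 [^] c' \<otimes> fam_val K_gen ws \<otimes> b 0 [^] (- (c' + word_weight ?W ws)) \<in> ?U"
    using Cons.IH[of c'] Cons.prems by (simp add: c'_def)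
  ultimately have "(b 0 [^] c \<otimes> z \<otimes> b 0 [^] (- c')) \<otimes>
      (b 0 [^] c' \<otimes> fam_val K_gen ws \<otimes> b 0 [^] (- (c' + word_weight ?W ws))) \<in> ?U" (is "?e \<in> _")
    by (rule subgroup.m_closed[OF sub])
  also have "?e = b 0 [^] c \<otimes> z \<otimes> (b 0 [^] (- c') \<otimes> b 0 [^] c') \<otimes>
      (fam_val K_gen ws \<otimes> b 0 [^] (- (c' + word_weight ?W ws)))"
    using z w by (simp add: m_assoc)
  also have "b 0 [^] (- c') \<otimes> b 0 [^] c' = \<one>"
    by (simp add: int_pow_mult[symmetric])
  finally have "b 0 [^] c \<otimes> (z \<otimes> fam_val K_gen ws) \<otimes> b 0 [^] (- (c' + word_weight ?W ws)) \<in> ?U"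
    using z w by (simp add: m_assoc)
  moreover have "fam_val K_gen (l # ws) = z \<otimes> fam_val K_gen ws"
    by (simp only: fam_val_Cons z_def j_def)
  moreover have "c + word_weight ?W (l # ws) = c' + word_weight ?W ws"
    by (simp add: c'_def)
  ultimately show ?case by (simp only:)
qed

text \<open>An element of the intersection has a word in \<open>K_gen\<close> whose heights survive
  in its reduced form, and a word from \<open>H\<close> that stays in the strip. Uniqueness of
  reduced forms confines the \<open>K_gen\<close> word to the strip.\<close>

lemma inter_eq: "H \<inter> K = generate G (U_gen ` U_index)"
proof
  show "generate G (U_gen ` U_index) \<subseteq> H \<inter> K"
    using U_gen_in_H U_gen_in_K
    by (intro generate_subgroup_incl subgroups_Inter_pair subgroup_H subgroup_K) auto
next
  show "H \<inter> K \<subseteq> generate G (U_gen ` U_index)"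
  proof
    fix w assume w: "w \<in> H \<inter> K"
    obtain ws0 where "fst ` set ws0 \<subseteq> {..<k}" "w = fam_val K_gen ws0"
      using w generate_family[OF K.f_carrier] unfolding K_def by auto
    then obtain ws where ws: "reduced_word ws" "fst ` set ws \<subseteq> {..<k}" "fam_val K_gen ws = w"
      using reduce_word[OF K.f_carrier, of ws0 "\<lambda>_. 0"] by auto
    obtain vs where vs: "reduced_word vs" "fst ` set vs \<subseteq> {..<h + k - p - q}"
      "fam_val K_gen ws = fam_val b vs" "word_weight wt vs = word_weight (K.weight wt) ws"
      "heights (K.weight wt) 0 ws \<subseteq> heights wt 0 vs"
      using K.normal_form_weights[OF ws(1,2), of wt 0] wt_1 by blast
    obtain us0 where us0: "fst ` set us0 \<subseteq> {..<h + k - p - q}" "fam_val b us0 = w"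
      "word_weight wt us0 = 0" "heights wt 0 us0 \<subseteq> {0..int p}"
      using H_bounded_word w by blast
    obtain us where us: "reduced_word us" "fst ` set us \<subseteq> {..<h + k - p - q}" "fam_val b us = w"
      "word_weight wt us = 0" "heights wt 0 us \<subseteq> {0..int p}"
      using reduce_word[OF b_image us0(1), of wt] us0 by (metis subset_trans)
    have "us = vs"
      using reduced_word_unique[OF free_b us(1) vs(1) us(2) vs(2)] us(3) vs(3) ws(3) by simp
    moreover have W: "K.weight wt = (\<lambda>j. int (n j))"
      by (simp add: fun_eq_iff K_weight)
    ultimately have "heights (\<lambda>j. int (n j)) 0 ws \<subseteq> {0..int p}"
      "word_weight (\<lambda>j. int (n j)) ws = 0"
      using us(4,5) vs(4,5) by auto
    then show "w \<in> generate G (U_gen ` U_index)"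
      using bounded_word_in_U[OF ws(2), of 0] ws(3) w subgroup.mem_carrier[OF subgroup_H]
      by auto
  qed
qed

lemma rank_inter: "has_rank G (H \<inter> K) (\<Sum>j = 1..q. p + 1 - n j)"
proof -
  have fin: "finite {i. i + n j \<le> p}" for j
    by (rule finite_subset[of _ "{..p}"]) auto
  have "{i. i + n j \<le> p} = {..<p + 1 - n j}" for j by auto
  then have "card U_index = (\<Sum>j = 1..<k. p + 1 - n j)"
    unfolding U_index_def by (subst card_SigmaI) (auto simp: fin)
  \<comment> \<open>The indices above \<open>q\<close> contribute 0 because there
    \<open>n j = p + 1\<close>.\<close>
  also have "\<dots> = (\<Sum>j = 1..q. p + 1 - n j)"
    by (rule sum.mono_neutral_right) (use q n_extra in auto)
  finally show ?thesis
    using free_family_has_rank[OF conjugate_family.free_family[OF U_family]] fin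
    by (simp add: inter_eq U_index_def)
qed

text \<open>Every letter is itself a generator: x and E' occur in \<open>K\<close>, y and E in
  \<open>H\<close>.\<close>

lemma join_eq: "generate G (H \<union> K) = generate G (b ` {..<h + k - p - q})"
proof
  let ?F = "generate G (b ` {..<h + k - p - q})"
  have F: "subgroup ?F G" by (rule generate_is_subgroup[OF b_image])
  have bF: "b i \<in> ?F" if "i < h + k - p - q" for i
    using that by (auto intro: generate.incl)
  have pF: "b i [^] (m::int) \<in> ?F" if "i < h + k - p - q" for i m
    using that bF subgroup_int_pow_closed[OF F] by simp
  have "H_gen i \<in> ?F" if "i < h" for i
    unfolding H_gen_def
    by (cases "i \<le> p")
      (use that p q in \<open>auto intro!: subgroup.m_closed[OF F] bF pF simp del: diff_diff_left\<close>)
  then have "H \<subseteq> ?F" unfolding H_def by (intro generate_subgroup_incl F) auto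
  moreover have "K_gen j \<in> ?F" if "j < k" for j
    unfolding K_gen_def
    by (intro subgroup.m_closed[OF F] pF) (use that p q in \<open>auto simp: K_mid_def\<close>)
  then have "K \<subseteq> ?F" unfolding K_def by (intro generate_subgroup_incl F) auto
  ultimately show "generate G (H \<union> K) \<subseteq> ?F"
    by (intro generate_subgroup_incl F) auto
next
  have HK: "H \<union> K \<subseteq> carrier G"
    using subgroup.subset[OF subgroup_H] subgroup.subset[OF subgroup_K] by auto
  have "b i \<in> H \<union> K" if "i < h + k - p - q" for i
  proof -
    consider "i = 0" | "i = 1" | "2 \<le> i" "i \<le> h - p" | "h - p < i" "2 \<le> i" by linarith
    then show ?thesis
    proof cases
      case 1
      then show ?thesis using K_gen_in_K[of 0] K_gen_0 q by simp
    next
      case 2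
      then show ?thesis using H_gen_in_H[of 0] p by (simp add: H_gen_def)
    next
      case 3
      then have "\<not> i + p - 1 \<le> p" "i + p - 1 - p + 1 = i" by auto
      then have "H_gen (i + p - 1) = b i" by (simp only: H_gen_def if_False)
      then show ?thesis using H_gen_in_H[of "i + p - 1"] 3 p by auto
    next
      case 4
      \<comment> \<open>This inverts the index shift in \<open>K_mid\<close>.\<close>
      define j where "j = i + p + q - h"
      have "q < j" "j < k" "j + h - p - q = i" using 4 that p by (auto simp: j_def)
      then show ?thesis
        using K_gen_in_K[of j] that by (simp add: K_gen_def K_lft_def K_rgt_def K_mid_def K_exp_def)
    qed
  qed
  then have "b ` {..<h + k - p - q} \<subseteq> generate G (H \<union> K)"
    by (auto intro: generate.incl)
  then show "generate G (b ` {..<h + k - p - q}) \<subseteq> generate G (H \<union> K)"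
    by (intro generate_subgroup_incl generate_is_subgroup HK)
qed

lemma rank_join: "has_rank G (generate G (H \<union> K)) (h + k - p - q)"
  using free_family_has_rank[OF free_b] by (simp add: join_eq)

end

section \<open>Large free families in a non-abelian free group\<close>

text \<open>A group generated by at most one element is cyclic, hence commutative.\<close>

lemma (in group) nonabelian_basis_two_elements:
  assumes "generate G S = carrier G" "S \<subseteq> carrier G"
    and "x \<in> carrier G" "y \<in> carrier G" "x \<otimes> y \<noteq> y \<otimes> x"
  shows "\<exists>a\<in>S. \<exists>b\<in>S. a \<noteq> b"
proof (rule ccontr)
  assume "\<not> ?thesis"
  then have "S = {} \<or> (\<exists>a\<in>S. S = {a})" by blast
  then obtain a where a: "a \<in> carrier G" "S \<subseteq> {a}" using assms(2) by (auto intro: that[of \<one>])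
  then have "carrier G \<subseteq> {a [^] (m::int) |m. m \<in> UNIV}"
    using mono_generate[of S "{a}"] generate_pow[of a] assms(1) by simp
  then obtain l m :: int where "x = a [^] l" "y = a [^] m" using assms(3,4) by blast
  then show False using assms(5) a(1) by (simp add: int_pow_mult[symmetric] add.commute)
qed

text \<open>The conjugates have the same middle letter \<open>b\<close> but distinct exponents of
  \<open>a\<close>, so they form a conjugate family.\<close>

lemma (in group) free_family_of_basis:
  assumes "free_basis G S (carrier G)" "a \<in> S" "b \<in> S" "a \<noteq> b"
  shows "free_family (\<lambda>i::nat. a [^] int i \<otimes> b \<otimes> a [^] (- int i)) UNIV"
proof -
  have id: "map_prod id id = id" by auto
  have S: "free_family id S"
    using assms(1) unfolding free_basis_def free_family_def fam_val_def by (simp add: id)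
  interpret conjugate_family G id S a "\<lambda>i::nat. a [^] int i \<otimes> b \<otimes> a [^] (- int i)" UNIV
    int int "\<lambda>_. b" "\<lambda>_. 1"
    by unfold_locales (use S assms in \<open>auto simp: free_basis_def\<close>)
  show ?thesis by (rule free_family)
qed

section \<open>Choice of the numerical parameters\<close>

text \<open>Greedy choice: the last summand is \<open>min c p\<close>, and the rest is distributed
  by induction.\<close>

lemma bounded_summands:
  fixes c p q :: nat
  assumes "c \<le> p * q"
  shows "\<exists>m. (\<forall>j. m j \<le> p) \<and> (\<Sum>j = 1..q. m j) = c"
  using assms
proof (induction q arbitrary: c)
  case 0
  then show ?case by (intro exI[of _ "\<lambda>_. 0"]) auto
next
  case (Suc q)
  then have "c - min c p \<le> p * q" by auto
  then obtain m where m: "\<forall>j. m j \<le> p" "(\<Sum>j = 1..q. m j) = c - min c p"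
    using Suc.IH by blast
  have "(\<Sum>j = 1..q. (m(Suc q := min c p)) j) = (\<Sum>j = 1..q. m j)"
    by (rule sum.cong) auto
  with m(2) show ?case
    by (intro exI[of _ "m(Suc q := min c p)"]) (use m(1) in auto)
qed

text \<open>Up to \<open>p * q\<close>, take \<open>n j = p + 1 - m j\<close> for summands
  \<open>m j\<close> of \<open>c\<close>. One more unit comes from \<open>n q = 0\<close>, which
  contributes \<open>p + 1\<close>, while the other indices contribute \<open>p\<close>
  each.\<close>

lemma weights_exist:
  fixes c p q :: nat
  assumes "c \<le> p * q \<or> c = p * q + 1 \<and> 0 < q"
  shows "\<exists>n. n 0 = 1 \<and> (\<forall>j. j \<noteq> q \<longrightarrow> n j \<noteq> 0) \<and>
    (\<forall>j>q. n j = p + 1) \<and> (\<Sum>j = 1..q. p + 1 - n j) = c"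
proof (cases "c \<le> p * q")
  case True
  then obtain m where m: "\<forall>j. m j \<le> p" "(\<Sum>j = 1..q. m j) = c"
    using bounded_summands by blast
  let ?n = "\<lambda>j. if j = 0 then 1 else if j \<le> q then p + 1 - m j else p + 1"
  have "p + 1 - (p + 1 - m j) = m j" for j
    using m(1) by (simp add: le_SucI)
  then have "(\<Sum>j = 1..q. p + 1 - ?n j) = (\<Sum>j = 1..q. m j)"
    by (intro sum.cong) auto
  then show ?thesis
    using m by (intro exI[of _ ?n]) (auto simp: less_Suc_eq_le)
next
  case False
  then have c: "c = p * q + 1" and q: "0 < q" using assms by auto
  let ?n = "\<lambda>j. if j < q then 1 else if j = q then 0 else p + 1"
  obtain r where r: "q = Suc r" using q by (cases q) auto
  have "(\<Sum>j = 1..q. p + 1 - ?n j) = (\<Sum>j = 1..r. p + 1 - ?n j) + (p + 1)"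
    by (simp add: r)
  also have "(\<Sum>j = 1..r. p + 1 - ?n j) = (\<Sum>j = 1..r. p)"
    by (rule sum.cong) (auto simp: r)
  finally have "(\<Sum>j = 1..q. p + 1 - ?n j) = c" by (simp add: c r)
  then show ?thesis using q by (intro exI[of _ ?n]) auto
qed

text \<open>Write \<open>i = p + q\<close> as evenly as the bound \<open>p \<le> h - 1\<close> allows; then
  \<open>seq_a h i = p * q + 1\<close> unless \<open>i = 0\<close>.\<close>

lemma split_rank_defect:
  fixes h k c i :: nat
  assumes "2 \<le> h" "h \<le> k" "i \<le> h + k - 2" "c \<le> seq_a h i"
  shows "\<exists>p q. p < h \<and> q < k \<and> p + q = i \<and> (c \<le> p * q \<or> c = p * q + 1 \<and> 0 < q)"
proof -
  consider "i = 0" | "0 < i" "i \<le> 2 * (h - 1)" | "2 * (h - 1) < i" by linarith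
  then show ?thesis
  proof cases
    case 1
    then show ?thesis using assms by (intro exI[of _ 0]) (auto simp: seq_a_def)
  next
    case 2
    define p where "p = i div 2"
    have "i\<^sup>2 div 4 = p * (i - p)"
    proof (cases "even i")
      case True
      then have "i = 2 * p" by (simp add: p_def)
      then show ?thesis by (simp add: power2_eq_square)
    next
      case False
      then have i: "i = 2 * p + 1" by (simp add: p_def)
      have "i\<^sup>2 = 1 + 4 * (p * (p + 1))" by (simp add: i power2_eq_square algebra_simps)
      then have "i\<^sup>2 div 4 = p * (p + 1)" by simp
      moreover have "i - p = p + 1" using i by simp
      ultimately show ?thesis by simp
    qed
    then have c: "c \<le> p * (i - p) \<or> c = p * (i - p) + 1"
      using assms(4) 2 by (auto simp: seq_a_def)
    have "p < h" "i - p < k" "p + (i - p) = i" "0 < i - p"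
      using 2 assms unfolding p_def by linarith+
    with c show ?thesis by blast
  next
    case 3
    show ?thesis
      by (rule exI[of _ "h - 1"], rule exI[of _ "i - h + 1"])
        (use 3 assms in \<open>auto simp: seq_a_def split: if_splits\<close>)
  qed
qed

theorem theorem1p1:
  fixes F :: "'a monoid" and h k c v :: nat
  assumes "group F"
    and "\<exists>S. free_basis F S (carrier F)"
    and "\<exists>x\<in>carrier F. \<exists>y\<in>carrier F. x \<otimes>\<^bsub>F\<^esub> y \<noteq> y \<otimes>\<^bsub>F\<^esub> x"
    and "2 \<le> h" and "h \<le> k" and "2 \<le> v" and "v \<le> h + k"
    and "c \<le> (h - 1) * (k - 1) + 1"
    and "c \<le> seq_a h (h + k - v)"
  shows "\<exists>H K. subgroup H F \<and> subgroup K F \<and> has_rank F H h \<and> has_rank F K k \<and>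
           has_rank F (H \<inter> K) c \<and> has_rank F (generate F (H \<union> K)) v"
proof -
  interpret group F by fact
  obtain S where S: "free_basis F S (carrier F)" using assms(2) by blast
  then obtain s t where st: "s \<in> S" "t \<in> S" "s \<noteq> t"
    using nonabelian_basis_two_elements[of S] assms(3) unfolding free_basis_def by metis
  \<comment> \<open>This supplies arbitrarily many free letters even when \<open>S\<close> has only
    two elements.\<close>
  define b where "b = (\<lambda>i::nat. s [^]\<^bsub>F\<^esub> int i \<otimes>\<^bsub>F\<^esub> t \<otimes>\<^bsub>F\<^esub> s [^]\<^bsub>F\<^esub> (- int i))"
  have b: "free_family b UNIV" unfolding b_def by (rule free_family_of_basis[OF S st])
  obtain p q where pq: "p < h" "q < k" "p + q = h + k - v"
    "c \<le> p * q \<or> c = p * q + 1 \<and> 0 < q"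
    using split_rank_defect[OF assms(4,5) diff_le_mono2[OF assms(6)] assms(9)] by blast
  obtain n where n: "n 0 = 1" "\<forall>j. j \<noteq> q \<longrightarrow> n j \<noteq> 0"
    "\<forall>j>q. n j = p + 1" "(\<Sum>j = 1..q. p + 1 - n j) = c"
    using weights_exist[OF pq(4)] by blast
  interpret rank_construction F b p q h k n
    by unfold_locales (use b pq n in \<open>auto simp: free_family_def\<close>)
  \<comment> \<open>Natural subtraction is exact here because \<open>v \<le> h + k\<close>.\<close>
  have "h + k - p - q = v" using pq(3) assms by linarith
  then have "has_rank F (generate F (H \<union> K)) v" "has_rank F (H \<inter> K) c"
    using rank_join rank_inter n(4) by simp_all
  then show ?thesis
    using subgroup_H subgroup_K rank_H rank_K by blast
qed

end
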